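(* Let $\Gamma$ be a finitely generated group such that there exists $\alpha>0$ with $$\forall g\in\Gamma,\quad [g]_\infty\geqslant \alpha\,\ell(g).$$ Then every action of $\Gamma$ by isometries on a metric space $(X,d)$ for which the orbit map is a quasi-isometric embedding is well displacing.
   Context: Fix a finite generating set $S$ of $\Gamma$, with word length $\Vert\cdot\Vert$ and word metric $d_S$. The translation length is $\ell(\gamma)=\inf_{\eta\in\Gamma}\Vert\eta\gamma\eta^{-1}\Vert$. The stable norm is $[g]_\infty=\liminf_{n\to\infty}\frac1n\Vert g^n\Vert$. For an isometry $\gamma$ of a metric space $X$, the displacement is $d_X(\gamma)=\inf_{x\in X}d(x,\gamma(x))$. An action of $\Gamma$ by isometries on $X$ is well displacing if there exist positive constants $A,B$ such that $d_X(\gamma)\geqslant A\,\ell(\gamma)-B$ for all $\gamma\in\Gamma$. Orbit maps are the maps $\Gamma\to X$, $\gamma\mapsto\gamma(x)$; such a map is a quasi-isometric embedding if there are $A\geqslant 1$, $B\geqslant 0$ with $A^{-1}d_S(\gamma,\eta)-B\leqslant d(\gamma(x),\eta(x))\leqslant A\,d_S(\gamma,\eta)+B$ for all $\gamma,\eta\in\Gamma$ (this does not depend on $x$ nor on $S$). *)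

theory Defs
  imports
    "HOL-Algebra.Generated_Groups"
    "HOL-Algebra.Group_Action"
    "HOL-Analysis.Abstract_Metric_Spaces"
    "HOL-Library.Extended_Real"
begin

definition finite_generating_set :: "('a, 'c) monoid_scheme \<Rightarrow> 'a set \<Rightarrow> bool" where
  "finite_generating_set G S \<longleftrightarrow> finite S \<and> S \<subseteq> carrier G \<and> generate G S = carrier G"

definition word_length :: "('a, 'c) monoid_scheme \<Rightarrow> 'a set \<Rightarrow> 'a \<Rightarrow> nat" where
  "word_length G S g =
     (LEAST n. \<exists>ws. length ws = n \<and> set ws \<subseteq> S \<union> (\<lambda>s. inv\<^bsub>G\<^esub> s) ` S \<and>
                    foldr (\<otimes>\<^bsub>G\<^esub>) ws \<one>\<^bsub>G\<^esub> = g)"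

(* The left-invariant word metric: this is the one compared with orbits of left actions,
   where d (\<gamma> x) (\<eta> x) = d x (\<gamma>^-1 \<eta> x). *)
definition word_metric :: "('a, 'c) monoid_scheme \<Rightarrow> 'a set \<Rightarrow> 'a \<Rightarrow> 'a \<Rightarrow> nat" where
  "word_metric G S g h = word_length G S (inv\<^bsub>G\<^esub> g \<otimes>\<^bsub>G\<^esub> h)"

definition translation_length :: "('a, 'c) monoid_scheme \<Rightarrow> 'a set \<Rightarrow> 'a \<Rightarrow> real" where
  "translation_length G S g =
     (INF h\<in>carrier G. real (word_length G S (h \<otimes>\<^bsub>G\<^esub> g \<otimes>\<^bsub>G\<^esub> inv\<^bsub>G\<^esub> h)))"

(* Extended-real valued because the library's liminf lives in complete lattices. The term
   n = 0, which is 0 in HOL, does not affect the liminf. *)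
definition stable_norm :: "('a, 'c) monoid_scheme \<Rightarrow> 'a set \<Rightarrow> 'a \<Rightarrow> ereal" where
  "stable_norm G S g =
     liminf (\<lambda>n. ereal (real (word_length G S (g [^]\<^bsub>G\<^esub> n)) / real n))"

locale isometric_action = group_action G M \<phi> + Metric_space M d
  for G :: "('a, 'c) monoid_scheme" (structure)
    and M :: "'b set"
    and \<phi> :: "'a \<Rightarrow> 'b \<Rightarrow> 'b"
    and d :: "'b \<Rightarrow> 'b \<Rightarrow> real" +
  assumes isometry:
    "\<And>g x y. g \<in> carrier G \<Longrightarrow> x \<in> M \<Longrightarrow> y \<in> M \<Longrightarrow> d (\<phi> g x) (\<phi> g y) = d x y"

(* Only meaningful for nonempty M: the infimum of the empty set of reals is unspecified. *)
definition displacement :: "'b set \<Rightarrow> ('b \<Rightarrow> 'b \<Rightarrow> real) \<Rightarrow> ('b \<Rightarrow> 'b) \<Rightarrow> real" where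
  "displacement M d f = (INF x\<in>M. d x (f x))"

definition well_displacing ::
  "('a, 'c) monoid_scheme \<Rightarrow> 'a set \<Rightarrow> 'b set \<Rightarrow> ('b \<Rightarrow> 'b \<Rightarrow> real) \<Rightarrow> ('a \<Rightarrow> 'b \<Rightarrow> 'b) \<Rightarrow> bool" where
  "well_displacing G S M d \<phi> \<longleftrightarrow>
     (\<exists>A>0. \<exists>B>0. \<forall>g\<in>carrier G. displacement M d (\<phi> g) \<ge> A * translation_length G S g - B)"

definition orbit_map_qi_embedding ::
  "('a, 'c) monoid_scheme \<Rightarrow> 'a set \<Rightarrow> ('b \<Rightarrow> 'b \<Rightarrow> real) \<Rightarrow> ('a \<Rightarrow> 'b \<Rightarrow> 'b) \<Rightarrow> 'b \<Rightarrow> bool" where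
  "orbit_map_qi_embedding G S d \<phi> x \<longleftrightarrow>
     (\<exists>A\<ge>1. \<exists>B\<ge>0. \<forall>g\<in>carrier G. \<forall>h\<in>carrier G.
        inverse A * real (word_metric G S g h) - B \<le> d (\<phi> g x) (\<phi> h x) \<and>
        d (\<phi> g x) (\<phi> h x) \<le> A * real (word_metric G S g h) + B)"

end

theory Submission
  imports Defs
begin

text \<open>If an isometry \<open>\<gamma>\<close> moves some point \<open>y\<close> by \<open>\<delta>\<close>, then \<open>\<gamma>\<^sup>n\<close> moves \<open>y\<close> by at most \<open>n\<delta>\<close>, hence
  moves the base point \<open>x\<close> by at most \<open>n\<delta> + 2 d(x, y)\<close>. By the quasi-isometry inequality the
  length of \<open>\<gamma>\<^sup>n\<close> is at most \<open>An\<delta> + O(1)\<close>, so the stable norm of \<open>\<gamma>\<close> is at most \<open>A\<delta>\<close>.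
  Taking the infimum over \<open>y\<close> bounds the displacement from below by the stable norm over \<open>A\<close>.\<close>

context isometric_action
begin

lemma orbit_closed: "g \<in> carrier G \<Longrightarrow> x \<in> M \<Longrightarrow> \<phi> g x \<in> M"
  by (rule element_image) auto

lemma act_one: "x \<in> M \<Longrightarrow> \<phi> \<one> x = x"
  by (metis id_eq_one restrict_apply')

text \<open>Triangle inequality along y, g y, ..., g^n y: each power of g is an isometry, so all
  consecutive gaps equal \<open>d y (\<phi> g y)\<close>.\<close>

lemma dist_pow_le:
  assumes g: "g \<in> carrier G" and y: "y \<in> M"
  shows "d y (\<phi> (g [^] n) y) \<le> real n * d y (\<phi> g y)"
proof (induction n)
  case 0
  show ?case using y act_one by simp
next
  case (Suc n)
  interpret group G using group_hom group_hom.axioms(1) by blast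
  have gn: "g [^] n \<in> carrier G" using g by simp
  have "d y (\<phi> (g [^] Suc n) y) = d y (\<phi> (g [^] n) (\<phi> g y))"
    using composition_rule[OF y gn g] by simp
  also have "\<dots> \<le> d y (\<phi> (g [^] n) y) + d (\<phi> (g [^] n) y) (\<phi> (g [^] n) (\<phi> g y))"
    using y g gn by (intro triangle orbit_closed) auto
  also have "d (\<phi> (g [^] n) y) (\<phi> (g [^] n) (\<phi> g y)) = d y (\<phi> g y)"
    using y g gn by (intro isometry orbit_closed)
  finally show ?case using Suc.IH by (simp add: algebra_simps)
qed

text \<open>Follow the path x, y, g y, g x; its outer legs both have length
  \<open>d x y\<close>.\<close>

lemma dist_base_point_change:
  assumes g: "g \<in> carrier G" and x: "x \<in> M" and y: "y \<in> M"
  shows "d x (\<phi> g x) \<le> d y (\<phi> g y) + 2 * d x y"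
proof -
  have "d x (\<phi> g x) \<le> d x y + d y (\<phi> g x)"
    using assms by (intro triangle orbit_closed)
  moreover have "d y (\<phi> g x) \<le> d y (\<phi> g y) + d (\<phi> g y) (\<phi> g x)"
    using assms by (intro triangle orbit_closed)
  moreover have "d (\<phi> g y) (\<phi> g x) = d x y"
    using isometry[OF g y x] commute by simp
  ultimately show ?thesis by linarith
qed

text \<open>The lower bound is available only at x, while y stays arbitrary so that an infimum over
  it can be taken later. Passing between the two costs an amount independent of n, which disappears
  after division by n.\<close>

lemma stable_norm_le:
  assumes x: "x \<in> M" and y: "y \<in> M" and g: "g \<in> carrier G" and A: "A > 0"
    and lower: "\<And>h. h \<in> carrier G \<Longrightarrow> inverse A * real (word_length G S h) - B \<le> d x (\<phi> h x)"
  shows "stable_norm G S g \<le> ereal (A * d y (\<phi> g y))"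
proof -
  interpret group G using group_hom group_hom.axioms(1) by blast
  \<comment> \<open>The part of the bound on the length of g^n that does not grow with n.\<close>
  define C where "C = A * (B + 2 * d x y)"
  let ?u = "\<lambda>n. A * d y (\<phi> g y) + C * inverse (real n)"
  have bound: "real (word_length G S (g [^] n)) / real n \<le> ?u n" if "n > 0" for n
  proof -
    have gn: "g [^] n \<in> carrier G" using g by simp
    have "inverse A * real (word_length G S (g [^] n)) - B
        \<le> real n * d y (\<phi> g y) + 2 * d x y"
      using lower[OF gn] dist_base_point_change[OF gn x y] dist_pow_le[OF g y, of n] by linarith
    then have "real (word_length G S (g [^] n)) \<le> A * (real n * d y (\<phi> g y) + 2 * d x y + B)"
      using A by (simp add: field_simps)
    then show ?thesis using that by (simp add: C_def field_simps)
  qed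
  have "?u \<longlonglongrightarrow> A * d y (\<phi> g y) + C * 0"
    by (intro tendsto_intros lim_inverse_n)
  then have "(\<lambda>n. ereal (?u n)) \<longlonglongrightarrow> ereal (A * d y (\<phi> g y))"
    by simp
  then have "liminf (\<lambda>n. ereal (?u n)) = ereal (A * d y (\<phi> g y))"
    by (intro lim_imp_Liminf) auto
  moreover have "stable_norm G S g \<le> liminf (\<lambda>n. ereal (?u n))"
    unfolding stable_norm_def
  proof (rule Liminf_mono)
    show "\<forall>\<^sub>F n in sequentially.
        ereal (real (word_length G S (g [^] n)) / real n) \<le> ereal (?u n)"
      using eventually_gt_at_top[of 0] by eventually_elim (use bound in simp)
  qed
  ultimately show ?thesis by simp
qed

end

theorem proposition3p0p2:
  fixes G :: "('a, 'c) monoid_scheme"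
    and S :: "'a set"
    and M :: "'b set"
    and d :: "'b \<Rightarrow> 'b \<Rightarrow> real"
    and \<phi> :: "'a \<Rightarrow> 'b \<Rightarrow> 'b"
  assumes "group G"
    and "finite_generating_set G S"
    and "\<exists>\<alpha>>0. \<forall>g\<in>carrier G. stable_norm G S g \<ge> ereal (\<alpha> * translation_length G S g)"
    and "isometric_action G M \<phi> d"
    and "\<exists>x\<in>M. orbit_map_qi_embedding G S d \<phi> x"
  shows "well_displacing G S M d \<phi>"
proof -
  interpret group G by fact
  interpret isometric_action G M \<phi> d by fact
  from assms(3) obtain \<alpha> where \<alpha>: "\<alpha> > 0"
    and stable: "\<And>g. g \<in> carrier G \<Longrightarrow> ereal (\<alpha> * translation_length G S g) \<le> stable_norm G S g"
    by blast
  from assms(5) obtain x A B where x: "x \<in> M" and A: "A \<ge> 1"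
    and qi: "\<And>g h. g \<in> carrier G \<Longrightarrow> h \<in> carrier G \<Longrightarrow>
      inverse A * real (word_metric G S g h) - B \<le> d (\<phi> g x) (\<phi> h x)"
    unfolding orbit_map_qi_embedding_def by blast
  \<comment> \<open>Specialise to the pair (\<one>, h), where the word metric is the word length of
    h.\<close>
  have lower: "inverse A * real (word_length G S h) - B \<le> d x (\<phi> h x)" if h: "h \<in> carrier G" for h
    using qi[OF one_closed h] h act_one[OF x] by (simp add: word_metric_def)
  \<comment> \<open>The slope \<alpha> / A comes from chaining the hypothesis on \<alpha> with
    \<open>stable_norm_le\<close>; the 1 serves as the strictly positive additive constant in
    \<open>well_displacing\<close>.\<close>
  have pointwise: "\<alpha> / A * translation_length G S g - 1 \<le> d y (\<phi> g y)"
    if g: "g \<in> carrier G" and y: "y \<in> M" for g y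
  proof -
    have "ereal (\<alpha> * translation_length G S g) \<le> ereal (A * d y (\<phi> g y))"
      using A by (intro order_trans[OF stable[OF g] stable_norm_le[OF x y g _ lower]]) auto
    then have "\<alpha> / A * translation_length G S g \<le> d y (\<phi> g y)"
      using A by (simp add: field_simps)
    then show ?thesis by simp
  qed
  have "\<alpha> / A * translation_length G S g - 1 \<le> displacement M d (\<phi> g)" if "g \<in> carrier G" for g
    \<comment> \<open>The base point x shows that \<open>M\<close> is nonempty, so a pointwise lower
      bound passes to the infimum.\<close>
    unfolding displacement_def using x pointwise[OF that] by (intro cINF_greatest) auto
  moreover have "\<alpha> / A > 0" using \<alpha> A by simp
  ultimately show ?thesis
    unfolding well_displacing_def using zero_less_one by blast
qed

end
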